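(* Let $r_n,b_n,i_n,d_n,a_n$ ($n\ge 0$) denote respectively the numbers of all, bracketed, indecomposable, decomposable, and associate Rota-Baxter words of degree $n$ in the set $R$ (the case of one idempotent generator $x$ and one idempotent operator). Then, as formal power series in $z$, $$\sum_{n=0}^\infty r_n z^n=\frac{1-\sqrt{1-8z}}{2z},\qquad \sum_{n=0}^\infty b_n z^n=\frac{1-4z-\sqrt{1-8z}}{8z},$$ $$\sum_{n=0}^\infty i_n z^n=\frac{1-2z-\sqrt{1-8z}}{2(z+1)},\qquad \sum_{n=0}^\infty d_n z^n=\frac{1-7z+4z^2+(3z-1)\sqrt{1-8z}}{8z(z+1)},$$ $$\sum_{n=0}^\infty a_n z^n=\frac{3-4z-3\sqrt{1-8z}}{8z}.$$
   Context: Words are finite strings over the three symbols $x,\lfloor,\rfloor$. Let $R$ be the set consisting of the empty word $\emptyset$ together with all nonempty strings $w$ such that: (i) $w$ has equally many $\lfloor$ and $\rfloor$, and every prefix of $w$ has at least as many $\lfloor$ as $\rfloor$ (so brackets are balanced and matched into pairs in the usual way); (ii) no two $x$'s are adjacent in $w$; (iii) neither $\rfloor\lfloor$ nor $\lfloor\rfloor$ occurs as a substring of $w$; (iv) no two matched pairs of brackets are immediately nested, i.e. no substring $\lfloor\lfloor w'\rfloor\rfloor$ occurs in which the first $\lfloor$ is matched with the last $\rfloor$ and the second $\lfloor$ with the second-to-last $\rfloor$. Elements of $R$ are called Rota-Baxter words. The degree of a word is its number of matched pairs of brackets. So the degree-$0$ words are $\emptyset$ and $x$. A word in $R$ of degree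 $n>0$ is bracketed if it begins with $\lfloor$ and ends with $\rfloor$. A bracketed word is indecomposable if its first $\lfloor$ and last $\rfloor$ are matched with each other, and decomposable otherwise. A word of degree $n>0$ is an associate if it is not bracketed (equivalently it is of the form $xw$, $wx$ or $xwx$ with $w\in R$ bracketed). In degree $0$: no word is bracketed, indecomposable or decomposable, and the only associate is $x$. Square roots are the formal power series with constant term $1$. *)

theory Defs
  imports "HOL-Computational_Algebra.Formal_Power_Series" "HOL-Library.Sublist"
begin

text \<open>\<open>Gen\<close> is the generator \<open>x\<close>; \<open>LBr\<close> and \<open>RBr\<close> are the brackets
  \<open>\<lfloor>\<close> and \<open>\<rfloor>\<close>.\<close>
datatype letter = Gen | LBr | RBr

type_synonym rbword = "letter list"

definition balanced :: "rbword \<Rightarrow> bool" where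
  "balanced w \<longleftrightarrow>
     count_list w LBr = count_list w RBr \<and>
     (\<forall>u. prefix u w \<longrightarrow> count_list u RBr \<le> count_list u LBr)"

text \<open>Positions are counted from \<open>0\<close>.  The brackets at positions \<open>i < j\<close> form a matched pair
  iff the factor strictly between them is balanced.\<close>
definition matched :: "rbword \<Rightarrow> nat \<Rightarrow> nat \<Rightarrow> bool" where
  "matched w i j \<longleftrightarrow>
     i < j \<and> j < length w \<and> w ! i = LBr \<and> w ! j = RBr \<and>
     balanced (take (j - Suc i) (drop (Suc i) w))"

definition RB_words :: "rbword set" where
  "RB_words = {[]} \<union>
     {w. w \<noteq> [] \<and> balanced w \<and>
         \<not> sublist [Gen, Gen] w \<and>
         \<not> sublist [RBr, LBr] w \<and> \<not> sublist [LBr, RBr] w \<and>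
         \<not> (\<exists>i j. matched w i (Suc j) \<and> matched w (Suc i) j)}"

definition rb_degree :: "rbword \<Rightarrow> nat" where
  "rb_degree w = card {(i, j). matched w i j}"

definition bracketed :: "rbword \<Rightarrow> bool" where
  "bracketed w \<longleftrightarrow> w \<in> RB_words \<and> rb_degree w > 0 \<and> hd w = LBr \<and> last w = RBr"

definition indecomposable :: "rbword \<Rightarrow> bool" where
  "indecomposable w \<longleftrightarrow> bracketed w \<and> matched w 0 (length w - 1)"

definition decomposable :: "rbword \<Rightarrow> bool" where
  "decomposable w \<longleftrightarrow> bracketed w \<and> \<not> matched w 0 (length w - 1)"

definition associate :: "rbword \<Rightarrow> bool" where
  "associate w \<longleftrightarrow> w \<in> RB_words \<and> (if rb_degree w = 0 then w = [Gen] else \<not> bracketed w)"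

definition r_num :: "nat \<Rightarrow> nat" where
  "r_num n = card {w \<in> RB_words. rb_degree w = n}"

definition b_num :: "nat \<Rightarrow> nat" where
  "b_num n = card {w \<in> RB_words. rb_degree w = n \<and> bracketed w}"

definition i_num :: "nat \<Rightarrow> nat" where
  "i_num n = card {w \<in> RB_words. rb_degree w = n \<and> indecomposable w}"

definition d_num :: "nat \<Rightarrow> nat" where
  "d_num n = card {w \<in> RB_words. rb_degree w = n \<and> decomposable w}"

definition a_num :: "nat \<Rightarrow> nat" where
  "a_num n = card {w \<in> RB_words. rb_degree w = n \<and> associate w}"

definition gen_fun :: "(nat \<Rightarrow> nat) \<Rightarrow> real fps" where
  "gen_fun f = Abs_fps (\<lambda>n. of_nat (f n))"

definition fps_sqrt :: "real fps \<Rightarrow> real fps" where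
  "fps_sqrt f = fps_radical root 2 f"

text \<open>For constant term \<open>1\<close> this is the unique square root with constant term \<open>1\<close>.\<close>
lemma fps_sqrt_unique:
  assumes "fps_nth f 0 = 1"
  shows "fps_nth s 0 = 1 \<and> s ^ 2 = f \<longleftrightarrow> s = fps_sqrt f"
proof -
  have A: "fps_sqrt f ^ 2 = f" "fps_nth (fps_sqrt f) 0 = 1"
    using assms power_radical[of f root 1] by (auto simp: fps_sqrt_def numeral_2_eq_2)
  have "s = fps_sqrt f" if "fps_nth s 0 = 1" "s ^ 2 = f"
  proof -
    have "s = fps_sqrt f \<or> s = - fps_sqrt f"
      using that A by (metis power2_eq_iff)
    moreover have "s \<noteq> - fps_sqrt f"
    proof
      assume "s = - fps_sqrt f"
      hence "fps_nth s 0 = - fps_nth (fps_sqrt f) 0" by simp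
      thus False using that A by simp
    qed
    ultimately show ?thesis by blast
  qed
  thus ?thesis using A by blast
qed

text \<open>Division of formal power series by a series of positive order discards the polar part of the
  quotient.  Below, the divisors have order at most \<open>1\<close> and the numerators have constant term
  \<open>0\<close>, so all the quotients are exact.\<close>
lemma fps_div_mult_exact:
  fixes f g :: "real fps"
  assumes "g \<noteq> 0" "subdegree g \<le> 1" "fps_nth f 0 = 0"
  shows "f / g * g = f"
proof (cases "f = 0")
  case False
  hence "subdegree f > 0" using assms(3) by (metis gr0I nth_subdegree_nonzero)
  hence "g dvd f" using False assms by (simp add: fps_dvd_iff)
  thus ?thesis by simp
qed simp

end

theory Submission
  imports Defs
begin

text \<open>
  Write \<open>R, B, I, D, A\<close> for the five generating functions. The theorem is an instance of the
  symbolic method: each class of words is built from the others by an injective operation that adds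
  degrees, and each such operation is an algebraic identity between the series.

  \<^item> An indecomposable word is \<open>\<lfloor>c\<rfloor>\<close> with \<open>c\<close> a nonempty Rota-Baxter word that is not itself
    indecomposable, so \<open>I = z (R - 1 - I)\<close> (lemma \<open>indecomposable_eq\<close>).
  \<^item> In a decomposable word, the factor ending at the partner of the first bracket is indecomposable.
    As \<open>\<rfloor>\<lfloor>\<close> and \<open>xx\<close> are forbidden, it is followed by exactly one \<open>x\<close> and then by a bracketed
    word, so \<open>D = I B\<close> (lemma \<open>decomposable_eq\<close>).
  \<^item> An associate is \<open>x\<close>, or a bracketed word with an \<open>x\<close> added in front, behind, or on both sides,
    so \<open>A = 1 + 3 B\<close> (lemma \<open>associate_eq\<close>).
  \<^item> By definition \<open>B = I + D\<close> and \<open>R = 1 + A + B\<close>.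

  Elimination leaves the quadratic equation \<open>(1 + z) I\<^sup>2 - (1 - 2 z) I + z = 0\<close> for \<open>I\<close>, whose
  discriminant is \<open>(1 - 2 z)\<^sup>2 - 4 z (1 + z) = 1 - 8 z\<close>. The constant term of \<open>I\<close> is \<open>0\<close>, which
  selects the sign of the root, and the other four series follow linearly from \<open>I\<close>.

  The combinatorial part is a study of the excess of opening over closing brackets. It is
  nonnegative on prefixes and nonpositive on suffixes of a balanced word, and positive on proper
  nonempty prefixes of \<open>\<lfloor>c\<rfloor>\<close> with \<open>c\<close> balanced. Hence the forbidden factors \<open>\<lfloor>\<lfloor>m\<rfloor>\<rfloor>\<close> cannot
  straddle a boundary between balanced words.
\<close>

section \<open>Generating functions of combinatorial classes\<close>

definition class_gf :: "('a \<Rightarrow> nat) \<Rightarrow> 'a set \<Rightarrow> real fps" where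
  "class_gf sz S = Abs_fps (\<lambda>n. of_nat (card {w \<in> S. sz w = n}))"

text \<open>Since the cardinality of an infinite set is \<open>0\<close>, the sum and product rules for generating
  functions hold only for classes with finitely many objects of each size.\<close>

definition finite_levels :: "('a \<Rightarrow> nat) \<Rightarrow> 'a set \<Rightarrow> bool" where
  "finite_levels sz S \<longleftrightarrow> (\<forall>n. finite {w \<in> S. sz w = n})"

lemma finite_levels_subset: "finite_levels sz T \<Longrightarrow> S \<subseteq> T \<Longrightarrow> finite_levels sz S"
  unfolding finite_levels_def
  by (auto intro: finite_subset[of _ "{w \<in> T. sz w = n}" for n])

lemma class_gf_Un:
  assumes "finite_levels sz S" "finite_levels sz T" "S \<inter> T = {}"
  shows "class_gf sz (S \<union> T) = class_gf sz S + class_gf sz T"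
proof -
  have "card {w \<in> S \<union> T. sz w = n} = card {w \<in> S. sz w = n} + card {w \<in> T. sz w = n}" for n
  proof -
    have "{w \<in> S \<union> T. sz w = n} = {w \<in> S. sz w = n} \<union> {w \<in> T. sz w = n}" by auto
    thus ?thesis
      using assms by (auto simp: finite_levels_def intro!: card_Un_disjoint)
  qed
  thus ?thesis by (simp add: class_gf_def fps_eq_iff)
qed

lemma class_gf_singleton: "class_gf sz {w} = fps_X ^ sz w"
proof -
  have "{v \<in> {w}. sz v = n} = (if n = sz w then {w} else {})" for n by auto
  thus ?thesis by (simp add: class_gf_def fps_eq_iff fps_X_power_nth)
qed

lemma class_gf_image:
  assumes "inj_on f S" "\<And>w. w \<in> S \<Longrightarrow> sz' (f w) = sz w + k"
  shows "class_gf sz' (f ` S) = fps_X ^ k * class_gf sz S"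
proof -
  have "card {w \<in> f ` S. sz' w = n} = (if n < k then 0 else card {w \<in> S. sz w = n - k})" for n
  proof -
    have "{w \<in> f ` S. sz' w = n} = f ` {w \<in> S. sz w + k = n}" using assms(2) by auto
    moreover have "inj_on f {w \<in> S. sz w + k = n}" using assms(1) by (auto intro: inj_on_subset)
    ultimately have "card {w \<in> f ` S. sz' w = n} = card {w \<in> S. sz w + k = n}"
      by (simp add: card_image)
    moreover have "{w \<in> S. sz w + k = n} = (if n < k then {} else {w \<in> S. sz w = n - k})" by auto
    ultimately show ?thesis by simp
  qed
  thus ?thesis by (simp add: class_gf_def fps_eq_iff fps_X_power_mult_nth)
qed

lemma class_gf_Times:
  assumes "finite_levels sz S" "finite_levels sz' T"
  shows "class_gf (\<lambda>(u, v). sz u + sz' v) (S \<times> T) = class_gf sz S * class_gf sz' T"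
proof -
  have "card {p \<in> S \<times> T. (case p of (u, v) \<Rightarrow> sz u + sz' v) = n}
      = (\<Sum>k=0..n. card {u \<in> S. sz u = k} * card {v \<in> T. sz' v = n - k})" for n
  proof -
    have "{p \<in> S \<times> T. (case p of (u, v) \<Rightarrow> sz u + sz' v) = n}
        = (\<Union>k\<in>{0..n}. {u \<in> S. sz u = k} \<times> {v \<in> T. sz' v = n - k})" by auto
    also have "card \<dots> = (\<Sum>k=0..n. card ({u \<in> S. sz u = k} \<times> {v \<in> T. sz' v = n - k}))"
      using assms by (intro card_UN_disjoint) (auto simp: finite_levels_def)
    finally show ?thesis by (simp add: card_cartesian_product)
  qed
  thus ?thesis by (simp add: class_gf_def fps_eq_iff fps_mult_nth)
qed

section \<open>Balanced words and matched brackets\<close>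

definition excess :: "rbword \<Rightarrow> int" where
  "excess w = int (count_list w LBr) - int (count_list w RBr)"

abbreviation enclose :: "rbword \<Rightarrow> rbword" where
  "enclose u \<equiv> LBr # u @ [RBr]"

lemma excess_simps [simp]:
  "excess [] = 0"
  "excess (Gen # w) = excess w"
  "excess (LBr # w) = excess w + 1"
  "excess (RBr # w) = excess w - 1"
  "excess (u @ v) = excess u + excess v"
  by (simp_all add: excess_def)

lemma balanced_iff_excess:
  "balanced w \<longleftrightarrow> excess w = 0 \<and> (\<forall>u v. w = u @ v \<longrightarrow> 0 \<le> excess u)"
  by (auto simp: balanced_def excess_def prefix_def)

lemma balanced_excess: "balanced w \<Longrightarrow> excess w = 0"
  by (simp add: balanced_iff_excess)

lemma balanced_prefix_excess: "balanced (u @ v) \<Longrightarrow> 0 \<le> excess u"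
  by (simp add: balanced_iff_excess)

lemma balanced_suffix_excess: "balanced (u @ v) \<Longrightarrow> excess v \<le> 0"
  using balanced_excess[of "u @ v"] balanced_prefix_excess[of u v] by simp

lemma balanced_Nil [simp]: "balanced []"
  by (simp add: balanced_def)

lemma balanced_append:
  assumes "balanced u"
  shows "balanced (u @ v) \<longleftrightarrow> balanced v"
proof
  assume uv: "balanced (u @ v)"
  show "balanced v"
    unfolding balanced_iff_excess
  proof (intro conjI allI impI)
    show "excess v = 0" using uv assms by (simp add: balanced_iff_excess)
    fix p q assume "v = p @ q"
    hence "balanced ((u @ p) @ q)" using uv by simp
    from balanced_prefix_excess[OF this] show "0 \<le> excess p"
      using balanced_excess[OF assms] by simp
  qed
next
  assume v: "balanced v"
  show "balanced (u @ v)"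
    unfolding balanced_iff_excess
  proof (intro conjI allI impI)
    show "excess (u @ v) = 0" using assms v by (simp add: balanced_iff_excess)
    fix p q assume "u @ v = p @ q"
    then consider t where "u = p @ t" | t where "p = u @ t" "v = t @ q"
      by (auto simp: append_eq_append_conv2)
    thus "0 \<le> excess p"
      using assms v by cases (auto simp: balanced_iff_excess)
  qed
qed

lemma balanced_single_Gen [simp]: "balanced [Gen]"
  by (auto simp: balanced_iff_excess Cons_eq_append_conv)

lemma balanced_Gen_Cons [simp]: "balanced (Gen # w) \<longleftrightarrow> balanced w"
  using balanced_append[of "[Gen]" w] by simp

lemma balanced_append_Gen [simp]: "balanced (w @ [Gen]) \<longleftrightarrow> balanced w"
proof
  assume w: "balanced (w @ [Gen])"
  show "balanced w"
    unfolding balanced_iff_excess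
  proof (intro conjI allI impI)
    show "excess w = 0" using balanced_excess[OF w] by simp
    fix u v assume "w = u @ v"
    thus "0 \<le> excess u" using balanced_prefix_excess[of u "v @ [Gen]"] w by simp
  qed
qed (simp add: balanced_append)

lemma excess_enclose_prefix:
  assumes "balanced m" "enclose m = p @ q" "p \<noteq> []" "q \<noteq> []"
  shows "0 < excess p"
proof -
  obtain p' where p: "p = LBr # p'" using assms(2,3) by (cases p) auto
  obtain q' where q: "q = q' @ [RBr]" using assms(2,4) by (cases q rule: rev_cases) auto
  have "m = p' @ q'" using assms(2) p q by simp
  thus ?thesis using balanced_prefix_excess assms(1) p by fastforce
qed

lemma balanced_enclose [simp]:
  assumes "balanced u"
  shows "balanced (enclose u)"
  unfolding balanced_iff_excess
proof (intro conjI allI impI)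
  show "excess (enclose u) = 0" using balanced_excess[OF assms] by simp
  fix p q assume pq: "enclose u = p @ q"
  show "0 \<le> excess p"
  proof (cases "p = [] \<or> q = []")
    case True
    thus ?thesis using pq balanced_excess[OF assms] by auto
  next
    case False
    thus ?thesis using excess_enclose_prefix[OF assms pq] by simp
  qed
qed

lemma balanced_hd: "balanced w \<Longrightarrow> w \<noteq> [] \<Longrightarrow> hd w \<noteq> RBr"
  using balanced_prefix_excess[of "[hd w]" "tl w"] by auto

lemma balanced_last:
  assumes "balanced w" "w \<noteq> []"
  shows "last w \<noteq> LBr"
  using balanced_suffix_excess[of "butlast w" "[last w]"] assms by auto

text \<open>A closing bracket that makes the excess negative for the first time comes after a prefix of
  excess \<open>0\<close>, all of whose prefixes have nonnegative excess. Applied to what follows an opening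
  bracket, this yields the partner of that bracket.\<close>

lemma first_return:
  assumes "excess s < 0"
  obtains m s' where "s = m @ RBr # s'" "balanced m"
proof -
  define n where "n = (LEAST n. excess (take n s) < 0)"
  have ex: "excess (take (length s) s) < 0" using assms by simp
  have neg: "excess (take n s) < 0"
    unfolding n_def by (rule LeastI[of "\<lambda>n. excess (take n s) < 0", OF ex])
  have nonneg: "0 \<le> excess (take j s)" if "j < n" for j
    using not_less_Least[of j "\<lambda>n. excess (take n s) < 0"] that unfolding n_def by auto
  have "n \<noteq> 0" using neg by (cases n) auto
  then obtain k where k: "n = Suc k" by (cases n) auto
  have len: "k < length s"
    using Least_le[of "\<lambda>n. excess (take n s) < 0", OF ex] k unfolding n_def by simp
  have tk: "take n s = take k s @ [s ! k]" using k len by (simp add: take_Suc_conv_app_nth)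
  have R: "s ! k = RBr \<and> excess (take k s) = 0"
    using neg nonneg[of k] tk k by (cases "s ! k") auto
  have "balanced (take k s)"
    unfolding balanced_iff_excess
  proof (intro conjI allI impI)
    fix u v assume uv: "take k s = u @ v"
    hence "u = take (length u) (take k s)" by simp
    moreover have "length u \<le> k" using arg_cong[OF uv, of length] by simp
    ultimately have "u = take (length u) s" by (simp add: min_def)
    thus "0 \<le> excess u" using nonneg[of "length u"] \<open>length u \<le> k\<close> k by simp
  qed (use R in simp)
  moreover have "s = take k s @ RBr # drop (Suc k) s"
    using R len by (metis id_take_nth_drop)
  ultimately show ?thesis using that by blast
qed

text \<open>If the two words differed, the shorter one followed by \<open>\<rfloor>\<close> would be a prefix of the longer one
  with negative excess.\<close>

lemma first_return_unique:
  assumes "m @ RBr # s = m' @ RBr # s'" "balanced m" "balanced m'"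
  shows "m = m' \<and> s = s'"
proof -
  have no: False
    if "a = b @ RBr # t" "balanced a" "balanced b" for a b t :: rbword
    using balanced_prefix_excess[of "b @ [RBr]" t] that balanced_excess[of b] by simp
  from assms(1) obtain t where
    "(m = m' @ t \<and> t @ RBr # s = RBr # s') \<or> (m @ t = m' \<and> RBr # s = t @ RBr # s')"
    by (auto simp: append_eq_append_conv2)
  thus ?thesis
    using no[of m m'] no[of m' m] assms(2,3) by (cases t) auto
qed

lemma matched_iff:
  "matched w i j \<longleftrightarrow>
     (\<exists>p m s. w = p @ LBr # m @ RBr # s \<and> balanced m \<and> i = length p \<and> j = Suc (length p + length m))"
  (is "?l \<longleftrightarrow> ?r")
proof
  assume l: ?l
  define m where "m = take (j - Suc i) (drop (Suc i) w)"
  have ij: "i < j" "j < length w" "w ! i = LBr" "w ! j = RBr" and bal: "balanced m"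
    using l by (auto simp: matched_def m_def)
  have "drop (Suc i) w = m @ drop (j - Suc i) (drop (Suc i) w)"
    unfolding m_def by (rule append_take_drop_id[symmetric])
  also have "drop (j - Suc i) (drop (Suc i) w) = RBr # drop (Suc j) w"
    using ij Cons_nth_drop_Suc[of j w] by simp
  finally have "w = take i w @ LBr # m @ RBr # drop (Suc j) w"
    using ij by (metis id_take_nth_drop less_trans)
  moreover have "i = length (take i w)" "j = Suc (length (take i w) + length m)"
    using ij by (auto simp: m_def)
  ultimately show ?r using bal by blast
next
  assume ?r
  thus ?l by (auto simp: matched_def nth_append)
qed

text \<open>Every opening bracket of a balanced word has exactly one partner, so the degree, which counts
  matched pairs, can be read off as a letter count.\<close>

lemma rb_degree_balanced:
  assumes "balanced w"
  shows "rb_degree w = count_list w LBr"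
proof -
  let ?M = "{(i, j). matched w i j}"
  have "inj_on fst ?M"
  proof (intro inj_onI, clarsimp)
    fix i j j' assume "matched w i j" "matched w i j'"
    then obtain p m s p' m' s' where 1: "w = p @ LBr # m @ RBr # s" "balanced m" "i = length p"
        "j = Suc (length p + length m)" and
      2: "w = p' @ LBr # m' @ RBr # s'" "balanced m'" "i = length p'"
        "j' = Suc (length p' + length m')"
      unfolding matched_iff by blast
    have "m @ RBr # s = m' @ RBr # s'" using 1 2 by (metis append_eq_append_conv list.inject)
    with 1 2 show "j = j'" using first_return_unique by metis
  qed
  moreover have "fst ` ?M = {i. i < length w \<and> w ! i = LBr}"
  proof (intro equalityI subsetI)
    fix i assume "i \<in> {i. i < length w \<and> w ! i = LBr}"
    hence i: "w = take i w @ LBr # drop (Suc i) w" "i < length w"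
      by (auto simp: id_take_nth_drop[symmetric] dest: sym) (metis id_take_nth_drop)
    have "balanced ((take i w @ [LBr]) @ drop (Suc i) w)" using assms i by simp
    hence "excess (drop (Suc i) w) < 0"
      using balanced_excess balanced_prefix_excess[of "take i w" "LBr # drop (Suc i) w"] by fastforce
    then obtain m s where "drop (Suc i) w = m @ RBr # s" "balanced m" by (rule first_return)
    hence "matched w i (Suc (i + length m))"
      unfolding matched_iff using i by (metis length_take less_imp_le_nat min.absorb2)
    thus "i \<in> fst ` ?M" by force
  qed (auto simp: matched_def)
  ultimately have "rb_degree w = card {i. i < length w \<and> w ! i = LBr}"
    unfolding rb_degree_def using card_image by metis
  also have "\<dots> = count_list w LBr"
    by (simp add: count_list_eq_length_filter length_filter_conv_card eq_commute)
  finally show ?thesis .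
qed

section \<open>Rota-Baxter words through forbidden factors\<close>

definition adj_ok :: "letter \<Rightarrow> letter \<Rightarrow> bool" where
  "adj_ok a b \<longleftrightarrow> (a, b) \<notin> {(Gen, Gen), (RBr, LBr), (LBr, RBr)}"

definition nest_free :: "rbword \<Rightarrow> bool" where
  "nest_free w \<longleftrightarrow> (\<forall>m. balanced m \<longrightarrow> \<not> sublist (enclose (enclose m)) w)"

lemma successively_iff_sublist: "successively P w \<longleftrightarrow> (\<forall>a b. sublist [a, b] w \<longrightarrow> P a b)"
proof (induction w)
  case (Cons c w)
  show ?case
    using Cons by (cases w) (auto simp: sublist_Cons_right)
qed simp

text \<open>Two pairs at positions \<open>i, j + 1\<close> and \<open>i + 1, j\<close> are the outer brackets of a factor
  \<open>\<lfloor>\<lfloor>m\<rfloor>\<rfloor>\<close>, so the nesting condition, too, forbids factors and does not depend on positions. In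
  particular it is inherited by factors.\<close>

lemma nested_pair_iff:
  "(\<exists>i j. matched w i (Suc j) \<and> matched w (Suc i) j) \<longleftrightarrow> \<not> nest_free w"
proof
  assume "\<exists>i j. matched w i (Suc j) \<and> matched w (Suc i) j"
  then obtain i j p m s p' m' s' where 1: "w = p @ LBr # m @ RBr # s" "balanced m" "i = length p"
      "Suc j = Suc (length p + length m)" and
    2: "w = p' @ LBr # m' @ RBr # s'" "balanced m'" "Suc i = length p'"
      "j = Suc (length p' + length m')"
    unfolding matched_iff by blast
  have "(p @ [LBr]) @ m @ RBr # s = p' @ LBr # m' @ RBr # s'" "length (p @ [LBr]) = length p'"
    using 1 2 by auto
  hence "m @ RBr # s = enclose m' @ s'"
    by (metis append_eq_append_conv append.assoc append_Cons append_Nil)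
  moreover have "length m = length (enclose m')" using 1 2 by simp
  ultimately have "m = enclose m'" by (metis append_eq_append_conv)
  hence "w = p @ enclose (enclose m') @ s" using 1 by simp
  thus "\<not> nest_free w" unfolding nest_free_def sublist_def using 2(2) by blast
next
  assume "\<not> nest_free w"
  then obtain p m s where w: "w = p @ enclose (enclose m) @ s" and m: "balanced m"
    by (auto simp: nest_free_def sublist_def)
  have "matched w (length p) (Suc (length p + length (enclose m)))"
    unfolding matched_iff using w balanced_enclose[OF m]
    by (intro exI[of _ p] exI[of _ "enclose m"] exI[of _ s]) simp
  moreover have "matched w (length (p @ [LBr])) (Suc (length (p @ [LBr]) + length m))"
    unfolding matched_iff using w m
    by (intro exI[of _ "p @ [LBr]"] exI[of _ m] exI[of _ "RBr # s"]) simp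
  ultimately show "\<exists>i j. matched w i (Suc j) \<and> matched w (Suc i) j" by auto
qed

lemma nest_free_sublist: "nest_free w \<Longrightarrow> sublist v w \<Longrightarrow> nest_free v"
  unfolding nest_free_def by (meson sublist_order.order.trans)

lemma nest_free_short: "length w < 4 \<Longrightarrow> nest_free w"
  unfolding nest_free_def using sublist_length_le by fastforce

lemma RB_words_iff: "w \<in> RB_words \<longleftrightarrow> balanced w \<and> successively adj_ok w \<and> nest_free w"
proof -
  have "successively adj_ok w \<longleftrightarrow>
      \<not> sublist [Gen, Gen] w \<and> \<not> sublist [RBr, LBr] w \<and> \<not> sublist [LBr, RBr] w"
    unfolding successively_iff_sublist adj_ok_def by auto
  thus ?thesis
    using nest_free_short[of "[]"] unfolding RB_words_def nested_pair_iff by auto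
qed

lemma RB_words_balanced: "w \<in> RB_words \<Longrightarrow> balanced w"
  by (simp add: RB_words_iff)

lemma RB_words_sublist: "w \<in> RB_words \<Longrightarrow> sublist v w \<Longrightarrow> balanced v \<Longrightarrow> v \<in> RB_words"
  unfolding RB_words_iff successively_iff_sublist
  by (meson nest_free_sublist sublist_order.order.trans)

text \<open>If \<open>\<lfloor>\<lfloor>m\<rfloor>\<rfloor>\<close> straddled the boundary, its part in \<open>u\<close> would have positive excess as a proper
  prefix of an enclosed word, but nonpositive excess as a suffix of \<open>u\<close>.\<close>

lemma nest_free_append:
  assumes "balanced u" "nest_free u" "nest_free v"
  shows "nest_free (u @ v)"
  unfolding nest_free_def
proof (intro allI impI notI)
  fix m assume m: "balanced m" and "sublist (enclose (enclose m)) (u @ v)"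
  then consider "sublist (enclose (enclose m)) u" | "sublist (enclose (enclose m)) v"
    | p q where "enclose (enclose m) = p @ q" "suffix p u" "prefix q v" "p \<noteq> []" "q \<noteq> []"
    unfolding sublist_append by (metis append_Nil append_Nil2 prefix_imp_sublist suffix_imp_sublist)
  thus False
  proof cases
    case 3
    from excess_enclose_prefix[OF balanced_enclose[OF m] 3(1,4,5)] have "0 < excess p" .
    moreover obtain t where "u = t @ p" using 3(2) by (auto simp: suffix_def)
    ultimately show False using balanced_suffix_excess assms(1) by fastforce
  qed (use assms m in \<open>auto simp: nest_free_def\<close>)
qed

text \<open>A forbidden factor of \<open>\<lfloor>c\<rfloor>\<close> that is not inside \<open>c\<close> must be the whole word: if it used only
  one of the two outer brackets, the rest of it would be a prefix of \<open>c\<close> with negative excess or a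
  suffix with positive excess.\<close>

lemma nest_free_enclose:
  assumes "balanced c"
  shows "nest_free (enclose c) \<longleftrightarrow> nest_free c \<and> (\<forall>m. balanced m \<longrightarrow> c \<noteq> enclose m)"
proof
  assume nf: "nest_free (enclose c)"
  have "sublist c (enclose c)" by (auto intro: sublist_Cons_right[THEN iffD2])
  moreover have "sublist (enclose c) (enclose c)" by simp
  ultimately show "nest_free c \<and> (\<forall>m. balanced m \<longrightarrow> c \<noteq> enclose m)"
    using nf nest_free_sublist[OF nf] unfolding nest_free_def by blast
next
  assume c: "nest_free c \<and> (\<forall>m. balanced m \<longrightarrow> c \<noteq> enclose m)"
  show "nest_free (enclose c)"
    unfolding nest_free_def
  proof (intro allI impI notI)
    fix m assume m: "balanced m" and "sublist (enclose (enclose m)) (enclose c)"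
    then obtain p s where eq: "enclose c = p @ enclose (enclose m) @ s" by (auto simp: sublist_def)
    have exm: "excess m = 0" by (rule balanced_excess[OF m])
    show False
    proof (cases p)
      case Nil
      show False
      proof (cases s rule: rev_cases)
        case Nil
        thus False using eq \<open>p = []\<close> c m by auto
      next
        case (snoc s' a)
        hence "c = (enclose m @ [RBr]) @ s'" using eq \<open>p = []\<close> by simp
        from balanced_prefix_excess[OF assms[unfolded this]] show False using exm by simp
      qed
    next
      case (Cons a p')
      show False
      proof (cases s rule: rev_cases)
        case Nil
        have "c @ [RBr] = (p' @ LBr # enclose m) @ [RBr]" using eq Cons Nil by simp
        hence "c = p' @ (LBr # enclose m)" by blast
        from balanced_suffix_excess[OF assms[unfolded this]] show False using exm by simp
      next
        case (snoc s' b)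
        have "c @ [RBr] = (p' @ enclose (enclose m) @ s') @ [b]" using eq Cons snoc by simp
        hence "c = p' @ enclose (enclose m) @ s'" by blast
        thus False using c m unfolding nest_free_def sublist_def by blast
      qed
    qed
  qed
qed

section \<open>Structure of the classes of words\<close>

abbreviation "brackets w \<equiv> count_list w LBr"

lemma rb_degree_RB_words: "w \<in> RB_words \<Longrightarrow> rb_degree w = brackets w"
  by (simp add: RB_words_balanced rb_degree_balanced)

lemma Nil_in_RB_words [simp]: "[] \<in> RB_words"
  by (simp add: RB_words_def)

lemma Gen_in_RB_words [simp]: "[Gen] \<in> RB_words"
  by (simp add: RB_words_iff nest_free_short)

lemma bracketed_iff: "bracketed w \<longleftrightarrow> w \<in> RB_words \<and> w \<noteq> [] \<and> hd w = LBr \<and> last w = RBr"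
  using rb_degree_RB_words[of w] by (cases w) (auto simp: bracketed_def)

lemma indecomposable_iff:
  "indecomposable w \<longleftrightarrow> w \<in> RB_words \<and> (\<exists>c. balanced c \<and> w = enclose c)"
proof -
  have "matched w 0 (length w - 1) \<longleftrightarrow> (\<exists>c. balanced c \<and> w = enclose c)"
    by (force simp: matched_iff)
  thus ?thesis by (auto simp: indecomposable_def bracketed_iff)
qed

lemma Nil_not_indecomposable [simp]: "\<not> indecomposable []"
  by (simp add: indecomposable_iff)

text \<open>A nonempty balanced word cannot begin with \<open>\<rfloor>\<close> or end with \<open>\<lfloor>\<close>, so enclosing it creates no
  forbidden pair of adjacent letters. For a Rota-Baxter word \<open>c\<close> the only obstructions are \<open>\<lfloor>\<rfloor>\<close> for empty \<open>c\<close> and immediate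
  nesting for indecomposable \<open>c\<close>.\<close>

lemma enclose_in_RB_words_iff:
  assumes "balanced c"
  shows "enclose c \<in> RB_words \<longleftrightarrow> c \<in> RB_words \<and> c \<noteq> [] \<and> \<not> indecomposable c"
proof (cases "c = []")
  case True
  thus ?thesis by (simp add: RB_words_iff adj_ok_def)
next
  case False
  have "adj_ok LBr (hd c)" "adj_ok (last c) RBr"
    using balanced_hd[OF assms False] balanced_last[OF assms False] by (auto simp: adj_ok_def)
  hence "successively adj_ok (enclose c) \<longleftrightarrow> successively adj_ok c"
    using False by (simp add: successively_Cons successively_append_iff)
  thus ?thesis
    using False assms by (auto simp: RB_words_iff indecomposable_iff nest_free_enclose)
qed

lemma indecomposable_eq:
  "{w. indecomposable w} = enclose ` (RB_words - ({[]} \<union> {w. indecomposable w}))"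
proof (intro equalityI subsetI)
  fix w assume "w \<in> {w. indecomposable w}"
  then obtain c where "balanced c" "w = enclose c" "enclose c \<in> RB_words"
    by (auto simp: indecomposable_iff)
  thus "w \<in> enclose ` (RB_words - ({[]} \<union> {w. indecomposable w}))"
    using enclose_in_RB_words_iff by auto
next
  fix w assume "w \<in> enclose ` (RB_words - ({[]} \<union> {w. indecomposable w}))"
  then obtain c where c: "w = enclose c" "c \<in> RB_words" "c \<noteq> []" "\<not> indecomposable c" by auto
  hence "balanced c" by (simp add: RB_words_balanced)
  thus "w \<in> {w. indecomposable w}"
    using c enclose_in_RB_words_iff[of c] indecomposable_iff[of w] by auto
qed

lemma RB_words_append_Gen:
  assumes "u \<in> RB_words" "v \<in> RB_words" "u \<noteq> [] \<Longrightarrow> last u \<noteq> Gen" "v \<noteq> [] \<Longrightarrow> hd v \<noteq> Gen"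
  shows "u @ Gen # v \<in> RB_words"
proof -
  have "nest_free (Gen # v)"
    using nest_free_append[of "[Gen]" v] assms(2) by (simp add: RB_words_iff nest_free_short)
  hence "nest_free (u @ Gen # v)" using assms(1) by (simp add: RB_words_iff nest_free_append)
  moreover have "balanced (u @ Gen # v)" using assms by (simp add: RB_words_iff balanced_append)
  moreover have "successively adj_ok (u @ Gen # v)"
    using assms by (auto simp: RB_words_iff successively_append_iff successively_Cons adj_ok_def)
  ultimately show ?thesis by (simp add: RB_words_iff)
qed

lemma decomposable_eq:
  "{w. decomposable w} = (\<lambda>(u, v). u @ Gen # v) ` ({w. indecomposable w} \<times> {w. bracketed w})"
proof (intro equalityI subsetI)
  fix w assume "w \<in> {w. decomposable w}"
  hence b: "bracketed w" and ni: "\<not> indecomposable w"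
    by (auto simp: decomposable_def indecomposable_def)
  have w: "w \<in> RB_words" "balanced w" "w \<noteq> []" "hd w = LBr" "last w = RBr"
    using b by (auto simp: bracketed_iff RB_words_balanced)
  obtain t where t: "w = LBr # t" using w by (cases w) auto
  have "excess t < 0" using balanced_excess[OF w(2)] t by simp
  then obtain c s where c: "t = c @ RBr # s" "balanced c" by (rule first_return)
  have weq: "w = enclose c @ s" using t c by simp
  have bs: "balanced s" using w(2) c(2) balanced_append[OF balanced_enclose] weq by metis
  have "s \<noteq> []" using ni w(1) c(2) weq by (auto simp: indecomposable_iff)
  moreover have adj: "successively adj_ok w" using w(1) by (simp add: RB_words_iff)
  ultimately have "hd s \<noteq> LBr" unfolding weq
    by (auto simp: successively_append_iff adj_ok_def successively_Cons)
  hence "hd s = Gen" using balanced_hd[OF bs \<open>s \<noteq> []\<close>] by (cases "hd s") auto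
  then obtain v where v: "s = Gen # v" using \<open>s \<noteq> []\<close> by (cases s) auto
  have bv: "balanced v" using bs v by simp
  have "v \<noteq> []" using w(5) weq v by auto
  have "hd v \<noteq> Gen" using adj \<open>v \<noteq> []\<close> unfolding weq v
    by (cases v) (auto simp: successively_append_iff adj_ok_def successively_Cons)
  hence "hd v = LBr" using balanced_hd[OF bv \<open>v \<noteq> []\<close>] by (cases "hd v") auto
  moreover have "last v = RBr" using w(5) \<open>v \<noteq> []\<close> weq v by auto
  moreover have "sublist v w" unfolding weq v sublist_def
    by (rule exI[of _ "enclose c @ [Gen]"], rule exI[of _ "[]"]) simp
  ultimately have "bracketed v"
    using RB_words_sublist[OF w(1) _ bv] \<open>v \<noteq> []\<close> by (simp add: bracketed_iff)
  moreover have "sublist (enclose c) w" unfolding weq unfolding sublist_def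
    by (rule exI[of _ "[]"], rule exI[of _ s]) simp
  hence "indecomposable (enclose c)"
    using RB_words_sublist[OF w(1)] c(2) by (auto simp: indecomposable_iff)
  ultimately show "w \<in> (\<lambda>(u, v). u @ Gen # v) ` ({w. indecomposable w} \<times> {w. bracketed w})"
    using weq v by (intro image_eqI[of _ _ "(enclose c, v)"]) auto
next
  fix w assume "w \<in> (\<lambda>(u, v). u @ Gen # v) ` ({w. indecomposable w} \<times> {w. bracketed w})"
  then obtain u v where uv: "indecomposable u" "bracketed v" "w = u @ Gen # v" by auto
  then obtain c where c: "balanced c" "u = enclose c" by (auto simp: indecomposable_iff)
  have "w \<in> RB_words"
    unfolding uv(3)
    using uv(1,2) c by (intro RB_words_append_Gen) (auto simp: bracketed_iff indecomposable_def)
  hence b: "bracketed w" using uv c by (auto simp: bracketed_iff)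
  have "\<not> indecomposable w"
  proof
    assume "indecomposable w"
    then obtain d where "balanced d" "enclose d = w" by (auto simp: indecomposable_iff)
    hence "d @ RBr # [] = c @ RBr # Gen # v" "balanced d" using uv c by auto
    from first_return_unique[OF this c(1)] show False by simp
  qed
  thus "w \<in> {w. decomposable w}" using b by (simp add: decomposable_def indecomposable_def)
qed

text \<open>The first factor is recovered as the part of the word up to the partner of its first bracket.\<close>

lemma inj_on_append_Gen_indecomposable:
  "inj_on (\<lambda>(u, v). u @ Gen # v) ({w. indecomposable w} \<times> T)"
  by (auto simp: inj_on_def indecomposable_iff dest!: first_return_unique)

text \<open>A nonempty word that begins and ends with brackets must begin with an opening and end with a
  closing one, hence is bracketed. Otherwise there is an \<open>x\<close> at an end, and removing it exposes a
  bracket or nothing, since \<open>xx\<close> is forbidden.\<close>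

lemma RB_words_cases:
  assumes "w \<in> RB_words"
  obtains "w = []" | "w = [Gen]" | "bracketed w"
    | v where "bracketed v" "w = Gen # v" | v where "bracketed v" "w = v @ [Gen]"
    | v where "bracketed v" "w = Gen # v @ [Gen]"
proof -
  have core: "bracketed v"
    if "v \<in> RB_words" "v \<noteq> []" "hd v \<noteq> Gen" "last v \<noteq> Gen" for v
  proof -
    have "hd v = LBr" using that balanced_hd[OF RB_words_balanced] by (cases "hd v") auto
    moreover have "last v = RBr"
      using that balanced_last[OF RB_words_balanced] by (cases "last v") auto
    ultimately show ?thesis using that by (simp add: bracketed_iff)
  qed
  have strip_front: "v \<in> RB_words \<and> (v \<noteq> [] \<longrightarrow> hd v \<noteq> Gen)" if "Gen # v \<in> RB_words" for v
  proof
    show "v \<in> RB_words"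
      using that RB_words_balanced[OF that] RB_words_sublist[OF that]
      by (auto simp: sublist_Cons_right)
    show "v \<noteq> [] \<longrightarrow> hd v \<noteq> Gen"
      using that by (auto simp: RB_words_iff successively_Cons adj_ok_def)
  qed
  have strip_back: "v \<in> RB_words \<and> (v \<noteq> [] \<longrightarrow> last v \<noteq> Gen)" if "v @ [Gen] \<in> RB_words" for v
  proof
    show "v \<in> RB_words"
      using RB_words_balanced[OF that] RB_words_sublist[OF that] by simp
    show "v \<noteq> [] \<longrightarrow> last v \<noteq> Gen"
      using that by (auto simp: RB_words_iff successively_append_iff adj_ok_def)
  qed
  consider "w = []" | "w \<noteq> []" "hd w \<noteq> Gen" "last w \<noteq> Gen" | v where "w = Gen # v"
    | v where "w = v @ [Gen]" "w \<noteq> []" "hd w \<noteq> Gen"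
    by (metis append_butlast_last_id list.collapse)
  thus thesis
  proof cases
    case 2
    thus thesis using core assms that by blast
  next
    case (3 v)
    note v = strip_front[OF assms[unfolded 3]]
    consider "v = []" | "v \<noteq> []" "last v \<noteq> Gen" | u where "v = u @ [Gen]"
      by (metis append_butlast_last_id)
    thus thesis
    proof cases
      case 2
      thus thesis using core v 3 that by blast
    next
      case (3 u)
      with v strip_back[of u] have u: "u \<in> RB_words" "u \<noteq> [] \<Longrightarrow> last u \<noteq> Gen" "u \<noteq> []" "hd u \<noteq> Gen"
        by (cases u; auto)+
      thus thesis using core[of u] \<open>w = Gen # v\<close> 3 that by blast
    qed (use 3 that in blast)
  next
    case (4 v)
    with strip_back[of v] assms have "v \<in> RB_words" "last v \<noteq> Gen" "v \<noteq> []" "hd v \<noteq> Gen"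
      by (cases v; auto)+
    thus thesis using core[of v] 4 that by blast
  qed (use that in blast)
qed

lemma RB_words_with_outer_Gen:
  assumes "bracketed v"
  shows "Gen # v \<in> RB_words" "v @ [Gen] \<in> RB_words" "Gen # v @ [Gen] \<in> RB_words"
proof -
  have v: "v \<in> RB_words" "v \<noteq> []" "hd v = LBr" "last v = RBr" using assms by (auto simp: bracketed_iff)
  show "Gen # v \<in> RB_words" using RB_words_append_Gen[of "[]" v] v by simp
  thus "Gen # v @ [Gen] \<in> RB_words" using RB_words_append_Gen[of "Gen # v" "[]"] v by simp
  show "v @ [Gen] \<in> RB_words" using RB_words_append_Gen[of v "[]"] v by simp
qed

lemma associate_iff: "associate w \<longleftrightarrow> w \<in> RB_words \<and> w \<noteq> [] \<and> \<not> bracketed w"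
proof (cases "w \<in> RB_words")
  case True
  have pos: "0 < brackets v" if "bracketed v" for v
    using that rb_degree_RB_words[of v] by (auto simp: bracketed_def)
  from True show ?thesis
    by (cases rule: RB_words_cases)
      (use True pos in \<open>auto simp: associate_def rb_degree_RB_words bracketed_iff\<close>)
qed (simp add: associate_def)

lemma associate_eq:
  "{w. associate w} = {[Gen]} \<union> ((Cons Gen ` {w. bracketed w} \<union> (\<lambda>w. w @ [Gen]) ` {w. bracketed w})
     \<union> (\<lambda>w. Gen # w @ [Gen]) ` {w. bracketed w})" (is "_ = ?r")
proof (intro equalityI subsetI)
  fix w assume "w \<in> {w. associate w}"
  hence w: "w \<in> RB_words" "w \<noteq> []" "\<not> bracketed w" by (auto simp: associate_iff)
  from w(1) show "w \<in> ?r"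
    by (cases rule: RB_words_cases) (use w in auto)
next
  fix w assume "w \<in> ?r"
  thus "w \<in> {w. associate w}"
    by (auto simp: associate_iff RB_words_with_outer_Gen) (auto simp: bracketed_iff)
qed

section \<open>The generating functions\<close>

text \<open>Without \<open>xx\<close>, every \<open>x\<close> except one in last position is followed by its own bracket. This
  bounds the length of a word in terms of its degree. If the word does not begin with \<open>x\<close>, the
  first bracket is to spare; recording this saved unit makes the induction over letters work.\<close>

lemma count_Gen_le:
  "successively adj_ok w \<Longrightarrow>
     count_list w Gen + (if w \<noteq> [] \<and> hd w = Gen then 0 else 1) \<le> count_list w LBr + count_list w RBr + 1"
proof (induction w)
  case (Cons a w)
  thus ?case by (cases a; cases w) (auto simp: adj_ok_def successively_Cons split: if_splits)
qed simp

lemma length_eq_counts: "length w = count_list w Gen + count_list w LBr + count_list w RBr"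
proof (induction w)
  case (Cons a w)
  thus ?case by (cases a) auto
qed simp

lemma finite_levels_RB_words: "finite_levels brackets RB_words"
  unfolding finite_levels_def
proof
  fix n
  have "length w \<le> 4 * n + 1" if "w \<in> RB_words" "brackets w = n" for w
  proof -
    have "count_list w RBr = n" using that by (simp add: RB_words_iff balanced_def)
    thus ?thesis
      using count_Gen_le[of w] that length_eq_counts[of w] by (simp add: RB_words_iff)
  qed
  hence "{w \<in> RB_words. brackets w = n} \<subseteq> {w. set w \<subseteq> {Gen, LBr, RBr} \<and> length w \<le> 4 * n + 1}"
    using letter.exhaust by blast
  thus "finite {w \<in> RB_words. brackets w = n}"
    by (rule finite_subset) (simp add: finite_lists_length_le)
qed

lemma gen_fun_eq_class_gf:
  assumes "\<And>n. f n = card {w \<in> RB_words. rb_degree w = n \<and> P w}" "\<And>w. P w \<Longrightarrow> w \<in> RB_words"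
  shows "gen_fun f = class_gf brackets {w. P w}"
proof -
  have "{w \<in> RB_words. rb_degree w = n \<and> P w} = {w \<in> {w. P w}. brackets w = n}" for n
    using assms(2) rb_degree_RB_words by auto
  thus ?thesis by (simp add: gen_fun_def class_gf_def assms(1))
qed

lemma gen_fun_system:
  defines "R \<equiv> gen_fun r_num" and "B \<equiv> gen_fun b_num" and "I \<equiv> gen_fun i_num"
    and "D \<equiv> gen_fun d_num" and "A \<equiv> gen_fun a_num"
  shows "R = 1 + A + B" "B = I + D" "I = fps_X * (R - 1 - I)" "D = I * B" "A = 1 + 3 * B"
proof -
  let ?gf = "class_gf brackets"
  have R: "R = ?gf RB_words"
    using gen_fun_eq_class_gf[of r_num "\<lambda>w. w \<in> RB_words"] unfolding R_def
    by (simp add: r_num_def conj_commute cong: conj_cong)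
  have B: "B = ?gf {w. bracketed w}" unfolding B_def
    by (rule gen_fun_eq_class_gf) (auto simp: b_num_def bracketed_def)
  have I: "I = ?gf {w. indecomposable w}" unfolding I_def
    by (rule gen_fun_eq_class_gf) (auto simp: i_num_def indecomposable_def bracketed_def)
  have D: "D = ?gf {w. decomposable w}" unfolding D_def
    by (rule gen_fun_eq_class_gf) (auto simp: d_num_def decomposable_def bracketed_def)
  have A: "A = ?gf {w. associate w}" unfolding A_def
    by (rule gen_fun_eq_class_gf) (auto simp: a_num_def associate_def)
  have fin: "finite_levels brackets S" if "S \<subseteq> RB_words" for S
    using finite_levels_subset[OF finite_levels_RB_words that] .
  have sub: "{w. bracketed w} \<subseteq> RB_words" "{w. indecomposable w} \<subseteq> RB_words"
    "{w. decomposable w} \<subseteq> RB_words" "{w. associate w} \<subseteq> RB_words"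
    by (auto simp: indecomposable_def decomposable_def bracketed_iff associate_iff)

  have "RB_words = ({[]} \<union> {w. associate w}) \<union> {w. bracketed w}"
    using sub by (auto simp: associate_iff)
  also have "?gf \<dots> = ?gf ({[]} \<union> {w. associate w}) + ?gf {w. bracketed w}"
    using sub by (intro class_gf_Un fin) (auto simp: associate_iff bracketed_iff)
  also have "?gf ({[]} \<union> {w. associate w}) = ?gf {[]} + ?gf {w. associate w}"
    using sub by (intro class_gf_Un fin) (auto simp: associate_iff)
  finally show "R = 1 + A + B" by (simp add: R A B class_gf_singleton)

  have "{w. bracketed w} = {w. indecomposable w} \<union> {w. decomposable w}"
    by (auto simp: indecomposable_def decomposable_def)
  also have "?gf \<dots> = ?gf {w. indecomposable w} + ?gf {w. decomposable w}"
    using sub by (intro class_gf_Un fin) (auto simp: indecomposable_def decomposable_def)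
  finally show "B = I + D" by (simp add: B I D)

  let ?C = "RB_words - ({[]} \<union> {w. indecomposable w})"
  have "RB_words = ({[]} \<union> {w. indecomposable w}) \<union> ?C" using sub by auto
  also have "?gf \<dots> = ?gf ({[]} \<union> {w. indecomposable w}) + ?gf ?C"
    using sub by (intro class_gf_Un fin) auto
  also have "?gf ({[]} \<union> {w. indecomposable w}) = ?gf {[]} + ?gf {w. indecomposable w}"
    using sub by (intro class_gf_Un fin) auto
  finally have C: "?gf ?C = R - 1 - I" by (simp add: R I class_gf_singleton)
  have "I = ?gf (enclose ` ?C)" unfolding I by (rule arg_cong[OF indecomposable_eq])
  also have "\<dots> = fps_X ^ 1 * ?gf ?C" by (rule class_gf_image) (auto simp: inj_on_def)
  finally show "I = fps_X * (R - 1 - I)" unfolding C by simp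

  have "D = fps_X ^ 0 * class_gf (\<lambda>(u, v). brackets u + brackets v)
      ({w. indecomposable w} \<times> {w. bracketed w})"
    unfolding D decomposable_eq
    by (rule class_gf_image) (auto simp: inj_on_append_Gen_indecomposable)
  also have "\<dots> = I * B" using sub by (simp add: class_gf_Times fin I B)
  finally show "D = I * B" .

  let ?B = "{w. bracketed w}"
  have img: "?gf (f ` ?B) = B" if "inj_on f ?B" "\<And>w. brackets (f w) = brackets w" for f
    using class_gf_image[of f ?B brackets brackets 0] that by (simp add: B)
  let ?X = "Cons Gen ` ?B" and ?Y = "(\<lambda>w. w @ [Gen]) ` ?B" and ?Z = "(\<lambda>w. Gen # w @ [Gen]) ` ?B"
  have sub': "{[Gen]} \<subseteq> RB_words" "?X \<subseteq> RB_words" "?Y \<subseteq> RB_words" "?Z \<subseteq> RB_words"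
    by (auto simp: RB_words_with_outer_Gen)
  \<comment> \<open>The four kinds of associates are told apart by their length and their first and last letters.\<close>
  have hdlast: "w \<noteq> [] \<and> hd w = LBr \<and> last w = RBr" if "w \<in> ?B" for w
    using that by (simp add: bracketed_iff)
  have disj1: "?X \<inter> ?Y = {}"
  proof -
    have "Gen # v \<noteq> u @ [Gen]" if "u \<in> ?B" for u v using hdlast[OF that] by (cases u) auto
    thus ?thesis by auto
  qed
  have disj2: "(?X \<union> ?Y) \<inter> ?Z = {}"
  proof -
    have "Gen # v \<noteq> Gen # u @ [Gen]" if "v \<in> ?B" for u v using hdlast[OF that] by auto
    moreover have "v @ [Gen] \<noteq> Gen # u @ [Gen]" if "v \<in> ?B" for u v
      using hdlast[OF that] by (cases v) auto
    ultimately show ?thesis by blast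
  qed
  have disj3: "{[Gen]} \<inter> ((?X \<union> ?Y) \<union> ?Z) = {}" using hdlast by force
  have "A = ?gf {[Gen]} + ?gf ((?X \<union> ?Y) \<union> ?Z)"
    unfolding A associate_eq using sub' disj3 by (intro class_gf_Un fin) auto
  also have "?gf ((?X \<union> ?Y) \<union> ?Z) = ?gf (?X \<union> ?Y) + ?gf ?Z"
    using sub' disj2 by (intro class_gf_Un fin) auto
  also have "?gf (?X \<union> ?Y) = ?gf ?X + ?gf ?Y"
    using sub' disj1 by (intro class_gf_Un fin) auto
  also have "?gf ?X = B" by (rule img) (auto simp: inj_on_def)
  also have "?gf ?Y = B" by (rule img) (auto simp: inj_on_def)
  also have "?gf ?Z = B" by (rule img) (auto simp: inj_on_def)
  finally show "A = 1 + 3 * B" by (simp add: class_gf_singleton)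
qed

theorem theorem3p1:
  shows "gen_fun r_num =
           (1 - fps_sqrt (1 - 8 * fps_X)) / (2 * fps_X)
       \<and> gen_fun b_num =
           (1 - 4 * fps_X - fps_sqrt (1 - 8 * fps_X)) / (8 * fps_X)
       \<and> gen_fun i_num =
           (1 - 2 * fps_X - fps_sqrt (1 - 8 * fps_X)) / (2 * (fps_X + 1))
       \<and> gen_fun d_num =
           (1 - 7 * fps_X + 4 * fps_X ^ 2 + (3 * fps_X - 1) * fps_sqrt (1 - 8 * fps_X))
             / (8 * fps_X * (fps_X + 1))
       \<and> gen_fun a_num =
           (3 - 4 * fps_X - 3 * fps_sqrt (1 - 8 * fps_X)) / (8 * fps_X)"
proof -
  define R B I D A where "R = gen_fun r_num" and "B = gen_fun b_num" and "I = gen_fun i_num"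
    and "D = gen_fun d_num" and "A = gen_fun a_num"
  note sys = gen_fun_system[folded R_def B_def I_def D_def A_def]
  define X :: "real fps" where "X = fps_X"
  have XB: "X * (1 + 4 * B) = I * (1 + X)"
  proof -
    have "I = X * (1 + 4 * B - I)" using sys(1,3,5) by (simp add: X_def algebra_simps)
    thus ?thesis by algebra
  qed
  have BI: "B * (1 - I) = I" using sys(2,4) by algebra
  have quad: "(1 + X) * I ^ 2 = (1 - 2 * X) * I - X" using XB BI by algebra
  \<comment> \<open>Completing the square: \<open>s\<close> is the root of the discriminant of this quadratic equation.\<close>
  define s where "s = 1 - 2 * X - 2 * (1 + X) * I"
  have "s ^ 2 = 1 - 8 * X" using quad unfolding s_def by algebra
  moreover have "fps_nth I 0 = 0" by (subst sys(3)) simp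
  hence "fps_nth s 0 = 1" by (simp add: s_def X_def)
  ultimately have s: "fps_sqrt (1 - 8 * X) = s"
    using fps_sqrt_unique[of "1 - 8 * X" s] by (simp add: X_def)
  have div: "f = g / h" if "h * f = g" "h \<noteq> 0" for f g h :: "real fps"
    using that by auto
  have eqs: "2 * X * R = 1 - s" "8 * X * B = 1 - 4 * X - s" "2 * (X + 1) * I = 1 - 2 * X - s"
    "8 * X * (X + 1) * D = 1 - 7 * X + 4 * X ^ 2 + (3 * X - 1) * s"
    "8 * X * A = 3 - 4 * X - 3 * s"
    using XB sys(1,2,5) s_def by algebra+
  have "fps_nth (X + 1) 0 \<noteq> 0" by (simp add: X_def)
  hence nonzero: "X \<noteq> 0" "X + 1 \<noteq> 0" by (auto simp: X_def simp del: fps_add_nth)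
  show ?thesis
    unfolding X_def[symmetric] s R_def[symmetric] B_def[symmetric] I_def[symmetric]
      D_def[symmetric] A_def[symmetric]
    by (intro conjI div eqs) (use nonzero in \<open>simp_all del: distrib_left_numeral\<close>)
qed

end
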